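(* Let $0<c<1$ and $f(x)=x^c$. Then \[ C_2(E_N(f))\gg N, \] i.e. there is a constant $\kappa>0$ (possibly depending on $c$) such that $C_2(E_N(f))\ge \kappa N$ for all sufficiently large $N$.
   Context: Define $\chi(x)=+1$ if $0\le\{x\}<1/2$ and $\chi(x)=-1$ if $1/2\le\{x\}<1$, where $\{x\}$ is the fractional part. For $N\ge1$, $E_N(f)=(e_1,\dots,e_N)$ with $e_n=\chi(f(n))$. The correlation measure of order $2$ of $E_N=(e_1,\dots,e_N)\in\{-1,+1\}^N$ is \[C_2(E_N)=\max_{M,d_1,d_2}\Big|\sum_{n=1}^M e_{n+d_1}e_{n+d_2}\Big|,\] the maximum over all positive integers $M$ and integers $0\le d_1<d_2$ with $M+d_2\le N$. *)

theory Defs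
  imports "HOL-Analysis.Analysis"
begin

definition chi :: "real \<Rightarrow> int" where
  "chi x = (if frac x < 1 / 2 then 1 else -1)"

text \<open>
  A finite sequence \<open>(e\<^sub>1, \<dots>, e\<^sub>N)\<close> is a list of length \<open>N\<close>; since list positions
  start at 0, the term \<open>e\<^sub>n\<close> is \<open>e ! (n - 1)\<close> for \<open>1 \<le> n \<le> N\<close>.
\<close>

definition E :: "nat \<Rightarrow> (real \<Rightarrow> real) \<Rightarrow> int list" where
  "E N f = map (\<lambda>n. chi (f (real n))) [1..<N + 1]"

text \<open>
  The maximum is over a finite set, which is nonempty exactly when the length is at
  least 2; for shorter sequences the value is unspecified.
\<close>

definition C2 :: "int list \<Rightarrow> int" where
  "C2 e = Max {\<bar>\<Sum>n = 1..M. e ! (n + d1 - 1) * e ! (n + d2 - 1)\<bar> | M d1 d2.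
                 0 < M \<and> d1 < d2 \<and> M + d2 \<le> length e}"

end

theory Submission
  imports Defs "HOL-Real_Asymp.Real_Asymp"
begin

text \<open>
  Adjacent terms already correlate. The value \<open>\<chi>(x)\<close> depends only on \<open>\<lfloor>2x\<rfloor>\<close>, and
  \<open>\<lfloor>2n\<^sup>c\<rfloor>\<close> is nondecreasing in \<open>n\<close> and increases by at most \<open>2N\<^sup>c\<close> in total for
  \<open>n \<le> N\<close>. So \<open>e\<^sub>n e\<^bsub>n+1\<^esub> = 1\<close> for all but \<open>2N\<^sup>c = o(N)\<close> of the \<open>n < N\<close>.
\<close>

lemma chi_cong_floor:
  assumes "\<lfloor>2 * x\<rfloor> = \<lfloor>2 * y\<rfloor>"
  shows "chi x = chi y"
proof -
  \<comment> \<open>The parity of \<open>\<lfloor>2 * z\<rfloor>\<close> records which half of the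
    unit interval contains the fractional part.\<close>
  have "frac z < 1 / 2 \<longleftrightarrow> even \<lfloor>2 * z\<rfloor>" for z :: real
  proof (cases "frac z < 1 / 2")
    case True
    then have "\<lfloor>2 * z\<rfloor> = 2 * \<lfloor>z\<rfloor>"
      unfolding frac_def by (simp add: floor_eq_iff)
    with True show ?thesis by simp
  next
    case False
    then have "\<lfloor>2 * z\<rfloor> = 2 * \<lfloor>z\<rfloor> + 1"
      unfolding frac_def by (simp add: floor_eq_iff) linarith
    with False show ?thesis by simp
  qed
  with assms show ?thesis by (simp add: chi_def)
qed

text \<open>Equal floors give product 1; otherwise the floors differ by at least 1 and the bound is
  at most -1, hence trivial. Being linear in the floor difference, it telescopes when
  summed.\<close>

lemma chi_mult_ge:
  assumes "x \<le> y"
  shows "chi x * chi y \<ge> 1 - 2 * (\<lfloor>2 * y\<rfloor> - \<lfloor>2 * x\<rfloor>)"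
proof (cases "\<lfloor>2 * x\<rfloor> = \<lfloor>2 * y\<rfloor>")
  case True
  then have "chi x = chi y" by (rule chi_cong_floor)
  with True show ?thesis by (simp add: chi_def)
next
  case False
  moreover have "\<lfloor>2 * x\<rfloor> \<le> \<lfloor>2 * y\<rfloor>" using assms by (intro floor_mono) simp
  ultimately have "\<lfloor>2 * x\<rfloor> < \<lfloor>2 * y\<rfloor>" by simp
  then have "1 - 2 * (\<lfloor>2 * y\<rfloor> - \<lfloor>2 * x\<rfloor>) \<le> -1" by (simp add: algebra_simps)
  also have "\<dots> \<le> chi x * chi y" by (simp add: chi_def)
  finally show ?thesis .
qed

lemma C2_ge:
  assumes "0 < M" "d1 < d2" "M + d2 \<le> length e"
  shows "\<bar>\<Sum>n = 1..M. e ! (n + d1 - 1) * e ! (n + d2 - 1)\<bar> \<le> C2 e"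
proof -
  let ?g = "\<lambda>(M, d1, d2). \<bar>\<Sum>n = 1..M. e ! (n + d1 - 1) * e ! (n + d2 - 1)\<bar>"
  let ?S = "{\<bar>\<Sum>n = 1..M. e ! (n + d1 - 1) * e ! (n + d2 - 1)\<bar> | M d1 d2.
                 0 < M \<and> d1 < d2 \<and> M + d2 \<le> length e}"
  \<comment> \<open>\<open>Max\<close> needs a finite set: \<open>M\<close>, \<open>d1\<close> and
    \<open>d2\<close> are all bounded by the length.\<close>
  have "?S \<subseteq> ?g ` ({..length e} \<times> {..length e} \<times> {..length e})"
    by (force simp: image_iff)
  then have "finite ?S" by (rule finite_subset) auto
  then show ?thesis unfolding C2_def using assms by (intro Max_ge) auto
qed

lemma C2_E_ge:
  assumes "mono_on {1..} f" and "N \<ge> 2"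
  shows "C2 (E N f) \<ge> int N - 1 - 2 * (\<lfloor>2 * f (real N)\<rfloor> - \<lfloor>2 * f 1\<rfloor>)"
proof -
  let ?g = "\<lambda>n::nat. \<lfloor>2 * f (real n)\<rfloor>"
  have nth: "E N f ! k = chi (f (real (Suc k)))" if "k < N" for k
    using that by (simp add: E_def del: upt_Suc)
  have "int (N - 1) - 2 * (?g N - ?g 1) = (\<Sum>n = 1..N - 1. 1 - 2 * (?g (Suc n) - ?g n))"
    using sum_Suc_diff[of 1 "N - 1" ?g] assms(2)
    by (simp add: sum_subtractf flip: sum_distrib_left)
  also have "\<dots> \<le> (\<Sum>n = 1..N - 1. E N f ! (n + 0 - 1) * E N f ! (n + 1 - 1))"
  proof (rule sum_mono)
    fix n assume n: "n \<in> {1..N - 1}"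
    then have "f (real n) \<le> f (real (Suc n))"
      by (intro mono_onD[OF assms(1)]) auto
    \<comment> \<open>Position \<open>n - 1\<close> holds the n-th term; since \<open>n\<close> is
      at least 1, the natural subtraction does not truncate.\<close>
    moreover have "E N f ! (n + 0 - 1) = chi (f (real n))"
      "E N f ! (n + 1 - 1) = chi (f (real (Suc n)))"
      using n nth[of "n - 1"] nth[of n] by auto
    ultimately
    show "1 - 2 * (?g (Suc n) - ?g n) \<le> E N f ! (n + 0 - 1) * E N f ! (n + 1 - 1)"
      using chi_mult_ge by simp
  qed
  \<comment> \<open>The witnesses are \<open>M = N - 1\<close>, \<open>d1 = 0\<close>,
    \<open>d2 = 1\<close>; \<open>N \<ge> 2\<close> makes \<open>M\<close> positive.\<close>
  also have "\<dots> \<le> C2 (E N f)"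
    using assms(2) by (intro order_trans[OF abs_ge_self C2_ge]) (auto simp: E_def)
  finally show ?thesis using assms(2) by simp
qed

theorem theorem3:
  fixes c :: real
  assumes "0 < c" and "c < 1"
  shows "\<exists>\<kappa>>0. \<forall>\<^sub>F N in sequentially.
           real_of_int (C2 (E N (\<lambda>x. x powr c))) \<ge> \<kappa> * real N"
proof (intro exI conjI)
  show "(1 / 2 :: real) > 0" by simp
  \<comment> \<open>The 4 comes from twice the floor of \<open>2 * real N powr c\<close>. As
    \<open>c < 1\<close>, any constant below 1 could replace 1/2.\<close>
  have "\<forall>\<^sub>F N :: nat in sequentially. real N - 4 * real N powr c \<ge> 1 / 2 * real N"
    using assms by real_asymp
  then show "\<forall>\<^sub>F N in sequentially.
      real_of_int (C2 (E N (\<lambda>x. x powr c))) \<ge> 1 / 2 * real N"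
    using eventually_ge_at_top[of 2]
  proof eventually_elim
    case (elim N)
    have "mono_on {1..} (\<lambda>x::real. x powr c)"
      using assms by (intro mono_onI powr_mono2) auto
    from C2_E_ge[OF this elim(2)]
    \<comment> \<open>The 3 is -1 + 2 * 2, because the floor at the left endpoint 1 equals
      2.\<close>
    have "C2 (E N (\<lambda>x. x powr c)) \<ge> int N + 3 - 2 * \<lfloor>2 * real N powr c\<rfloor>"
      by simp
    then have "real_of_int (C2 (E N (\<lambda>x. x powr c)))
        \<ge> real N + 3 - 2 * real_of_int \<lfloor>2 * real N powr c\<rfloor>"
      by linarith
    with elim(1) show ?case by linarith
  qed
qed

end
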